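(* Let $(M,\rho)$ be a perfect Polish metric space, let $X=\prod_{-\infty}^{+\infty}M$ with the metric $d$ given in the context, and let $T:X\to X$ be the full-shift. Let $\mu$ be an ergodic $T$-invariant Borel probability measure on $X$ such that $\dim_H(\mu)=0$, $\dim_P(\mu)=+\infty$, $\underline{R}(x)=0$ for $\mu$-a.e. $x$, and $\overline{R}(x)=+\infty$ for $\mu$-a.e. $x$. Then $$\underline{R}(x)=\underline{d}_\mu(x)=0\quad\text{and}\quad \overline{R}(x)=\overline{d}_\mu(x)=\infty\qquad\text{for }\mu\text{-a.e. }x\in X.$$
   Context: A Polish metric space is a complete separable metric space; it is perfect if it has no isolated points. $X=\prod_{-\infty}^{+\infty}M$ is the set of bilateral sequences $x=(x_n)_{n\in\mathbb{Z}}$ in $M$, with $d(x,y)=\sum_{n\in\mathbb{Z}}\frac{1}{2^{|n|}}\frac{\rho(x_n,y_n)}{1+\rho(x_n,y_n)}$, and $(Tx)_i=x_{i-1}$ for all $i\in\mathbb{Z}$. Dimensions of sets. Let $E\subset X$, $\alpha>0$. $H^\alpha(E)=\lim_{\delta\to0}\inf\{\sum_k(\operatorname{diam}E_k)^\alpha\}$, the infimum being over countable collections $\{E_k\}$ with $E\subset\bigcup_kE_k$ and $\operatorname{diam}(E_k)\le\delta$ ($\inf\emptyset=\infty$). For $0<\delta<1$, a $\delta$-packing of $E\neq\emptyset$ is a countable collection of disjoint closed balls $B(x_k,r_k)$ with specified centers $x_k\in E$ and radii $0<r_k\le\delta/2$; $P^\alpha_\delta(E)=\sup\sum_k(2r_k)^\alpha$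 over all $\delta$-packings of $E$, $P_\delta^\alpha(\emptyset)=0$, $P^\alpha_0(E)=\lim_{\delta\to0}P^\alpha_\delta(E)$, and $P^\alpha(E)=\inf\{\sum_kP^\alpha_0(E_k)\mid E\subset\bigcup_kE_k\}$ over countable coverings. Then $\dim_H(E)=\inf\{\alpha>0\mid H^\alpha(E)=0\}$ and $\dim_P(E)=\inf\{\alpha>0\mid P^\alpha(E)=0\}$ (with $\inf\emptyset=+\infty$). Dimensions of measures. For $K\in\{H,P\}$: $\dim_K^-(\mu)=\inf\{\dim_K(E)\mid \mu(E)>0,\ E \text{ Borel}\}$ and $\dim_K^+(\mu)=\inf\{\dim_K(E)\mid \mu(X\setminus E)=0,\ E\text{ Borel}\}$; $\dim_K(\mu)=c$ means $\dim_K^-(\mu)=\dim_K^+(\mu)=c$. Local dimensions. $\overline{d}_\mu(x)=\limsup_{\varepsilon\to0}\frac{\log\mu(B(x,\varepsilon))}{\log\varepsilon}$ and $\underline{d}_\mu(x)=\liminf_{\varepsilon\to0}\frac{\log\mu(B(x,\varepsilon))}{\log\varepsilon}$ if $\mu(B(x,\varepsilon))>0$ for all $\varepsilon>0$, and both are $+\infty$ otherwise. Recurrence rates. $\tau_r(x)=\inf\{k\in\mathbb{N}\mid T^kx\in\overline{B}(x,r)\}$ with $\mathbb{N}=\{1,2,\dots\}$, $\overline{B}(x,r)$ the closed ball, $\inf\emptyset=\infty$, $\log\infty=\infty$; $\underline{R}(x)=\liminf_{r\to0}\frac{\log\tau_r(x)}{-\log r}$ and $\overline{R}(x)=\limsup_{r\to0}\frac{\log\tau_r(x)}{-\log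 r}$. *)

theory Defs
  imports "HOL-Probability.Probability"
begin

section \<open>The space of bilateral sequences and the full shift\<close>

text \<open>
  A type copy of \<open>int \<Rightarrow> 'a\<close> is used because HOL-Analysis already equips \<open>int \<Rightarrow> 'a\<close>
  with a different metric (a weighted sum along an enumeration of the index type).
\<close>

typedef 'a biseq = "UNIV :: (int \<Rightarrow> 'a) set"
  morphisms coord Biseq
  by simp

setup_lifting type_definition_biseq

lemma biseq_eqI: "(\<And>i. coord x i = coord y i) \<Longrightarrow> x = y"
  by (simp add: coord_inject[symmetric] fun_eq_iff)

definition biseq_term :: "'a::metric_space biseq \<Rightarrow> 'a biseq \<Rightarrow> int \<Rightarrow> real" where
  "biseq_term x y n =
     1 / 2 ^ nat \<bar>n\<bar> * (dist (coord x n) (coord y n) / (1 + dist (coord x n) (coord y n)))"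

lemma summable_on_weights: "(\<lambda>n::int. 1 / 2 ^ nat \<bar>n\<bar> :: real) summable_on UNIV"
proof -
  have s: "(\<lambda>n::nat. (1/2::real) ^ n) summable_on UNIV"
    by (intro summable_nonneg_imp_summable_on summable_geometric) auto
  have 1: "(\<lambda>n::int. 1 / 2 ^ nat \<bar>n\<bar> :: real) summable_on (range int)"
    by (subst summable_on_reindex) (use s in \<open>auto simp: o_def power_one_over\<close>)
  have 2: "(\<lambda>n::int. 1 / 2 ^ nat \<bar>n\<bar> :: real) summable_on (range (\<lambda>k. - int k))"
    by (subst summable_on_reindex) (use s in \<open>auto simp: o_def power_one_over inj_on_def\<close>)
  have 3: "(\<lambda>n::int. 1 / 2 ^ nat \<bar>n\<bar> :: real) summable_on (range (\<lambda>k. - int k) - range int)"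
    by (rule summable_on_subset_banach[OF 2]) auto
  have "(UNIV :: int set) = range int \<union> (range (\<lambda>k. - int k) - range int)"
  proof -
    have "n \<in> range int \<union> range (\<lambda>k. - int k)" for n :: int
      by (cases n rule: int_cases2) auto
    then show ?thesis by auto
  qed
  then show ?thesis
    using summable_on_Un_disjoint[OF 1 3] by auto
qed

lemma biseq_term_nonneg: "0 \<le> biseq_term x y n"
  by (simp add: biseq_term_def)

lemma biseq_term_le: "biseq_term x y n \<le> 1 / 2 ^ nat \<bar>n\<bar>"
proof -
  have "dist (coord x n) (coord y n) / (1 + dist (coord x n) (coord y n)) \<le> 1"
    by (simp add: divide_le_eq_1 add_pos_nonneg)
  then have "1 / 2 ^ nat \<bar>n\<bar> * (dist (coord x n) (coord y n) / (1 + dist (coord x n) (coord y n)))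
      \<le> 1 / 2 ^ nat \<bar>n\<bar> * 1"
    by (intro mult_left_mono) auto
  then show ?thesis
    unfolding biseq_term_def by linarith
qed

lemma summable_on_biseq_term: "biseq_term x y summable_on UNIV"
  by (rule summable_on_comparison_test[OF summable_on_weights])
     (auto simp: biseq_term_nonneg biseq_term_le)

lemma bounded_dist_triangle:
  fixes a b c :: real
  assumes "0 \<le> a" "0 \<le> b" "0 \<le> c" "a \<le> b + c"
  shows "a / (1 + a) \<le> b / (1 + b) + c / (1 + c)"
proof -
  have "a / (1 + a) \<le> (b + c) / (1 + (b + c))"
    using assms by (simp add: divide_simps) (simp add: algebra_simps)
  also have "\<dots> = b / (1 + (b + c)) + c / (1 + (b + c))"
    by (simp add: add_divide_distrib)
  also have "\<dots> \<le> b / (1 + b) + c / (1 + c)"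
    using assms by (intro add_mono divide_left_mono) auto
  finally show ?thesis .
qed

lemma biseq_term_triangle: "biseq_term x y n \<le> biseq_term x z n + biseq_term y z n"
proof -
  have "dist (coord x n) (coord y n) / (1 + dist (coord x n) (coord y n))
     \<le> dist (coord x n) (coord z n) / (1 + dist (coord x n) (coord z n))
      + dist (coord y n) (coord z n) / (1 + dist (coord y n) (coord z n))"
    by (rule bounded_dist_triangle) (auto simp: dist_triangle2)
  then show ?thesis
    unfolding biseq_term_def distrib_left[symmetric] by (intro mult_left_mono) auto
qed

instantiation biseq :: (metric_space) metric_space
begin

definition dist_biseq :: "'a biseq \<Rightarrow> 'a biseq \<Rightarrow> real" where
  "dist_biseq x y = (\<Sum>\<^sub>\<infinity>n\<in>UNIV. 1 / 2 ^ nat \<bar>n\<bar> *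
     (dist (coord x n) (coord y n) / (1 + dist (coord x n) (coord y n))))"

definition uniformity_biseq :: "('a biseq \<times> 'a biseq) filter" where
  "uniformity_biseq = (INF e\<in>{0<..}. principal {(x, y). dist x y < e})"

definition open_biseq :: "'a biseq set \<Rightarrow> bool" where
  "open_biseq U \<longleftrightarrow> (\<forall>x\<in>U. eventually (\<lambda>(x', y). x' = x \<longrightarrow> y \<in> U) uniformity)"

instance
proof
  fix x y z :: "'a biseq"
  have d: "dist u v = infsum (biseq_term u v) UNIV" for u v :: "'a biseq"
    unfolding dist_biseq_def biseq_term_def ..
  show "dist x y \<le> dist x z + dist y z"
    unfolding d
    by (subst infsum_add[symmetric])
       (auto intro!: infsum_mono summable_on_add summable_on_biseq_term biseq_term_triangle)
  show "dist x y = 0 \<longleftrightarrow> x = y"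
  proof
    assume "dist x y = 0"
    then have z: "biseq_term x y n = 0" for n
      using nonneg_infsum_le_0D[OF _ summable_on_biseq_term, of x y n]
      by (auto simp: d biseq_term_nonneg)
    have "coord x n = coord y n" for n
    proof -
      have "1 + dist (coord x n) (coord y n) > 0"
        by (simp add: add_pos_nonneg)
      then show ?thesis
        using z[of n] by (auto simp: biseq_term_def)
    qed
    then show "x = y"
      by (rule biseq_eqI)
  next
    assume "x = y"
    then show "dist x y = 0"
      by (simp add: dist_biseq_def)
  qed
qed (fact uniformity_biseq_def open_biseq_def)+

end

lift_definition full_shift :: "'a biseq \<Rightarrow> 'a biseq" is "\<lambda>x i. x (i - 1)" .


section \<open>Hausdorff and packing dimension of sets\<close>

text \<open>
  Countable collections of sets are rendered as sequences; finite collections are padded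
  with empty sets, which contribute nothing. Since \<^const>\<open>diameter\<close> is real-valued and only
  meaningful on bounded sets, boundedness of the covering sets is stated explicitly.
\<close>

definition hausdorff_pre :: "real \<Rightarrow> real \<Rightarrow> 'a::metric_space set \<Rightarrow> ennreal" where
  "hausdorff_pre \<alpha> \<delta> E =
     (INF C \<in> {C :: nat \<Rightarrow> 'a set. E \<subseteq> (\<Union>k. C k) \<and> (\<forall>k. bounded (C k) \<and> diameter (C k) \<le> \<delta>)}.
        \<Sum>k. ennreal (diameter (C k) powr \<alpha>))"

definition hausdorff_measure :: "real \<Rightarrow> 'a::metric_space set \<Rightarrow> ennreal" where
  "hausdorff_measure \<alpha> E = Lim (at_right 0) (\<lambda>\<delta>. hausdorff_pre \<alpha> \<delta> E)"

text \<open>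
  A packing is a family of centres and radii over an index set \<open>I\<close> of natural numbers.
  The empty family is admitted, so the supremum is \<open>0\<close> for the empty set.
\<close>

definition is_packing ::
  "real \<Rightarrow> 'a::metric_space set \<Rightarrow> nat set \<Rightarrow> (nat \<Rightarrow> 'a) \<Rightarrow> (nat \<Rightarrow> real) \<Rightarrow> bool" where
  "is_packing \<delta> E I c r \<longleftrightarrow>
     (\<forall>k\<in>I. c k \<in> E \<and> 0 < r k \<and> r k \<le> \<delta> / 2) \<and>
     disjoint_family_on (\<lambda>k. cball (c k) (r k)) I"

definition packing_pre :: "real \<Rightarrow> real \<Rightarrow> 'a::metric_space set \<Rightarrow> ennreal" where
  "packing_pre \<alpha> \<delta> E =
     (SUP (I, c, r) \<in> {(I, c, r). is_packing \<delta> E I c r}.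
        \<Sum>\<^sub>\<infinity>k\<in>I. ennreal ((2 * r k) powr \<alpha>))"

definition packing_pre0 :: "real \<Rightarrow> 'a::metric_space set \<Rightarrow> ennreal" where
  "packing_pre0 \<alpha> E = Lim (at_right 0) (\<lambda>\<delta>. packing_pre \<alpha> \<delta> E)"

definition packing_measure :: "real \<Rightarrow> 'a::metric_space set \<Rightarrow> ennreal" where
  "packing_measure \<alpha> E =
     (INF C \<in> {C :: nat \<Rightarrow> 'a set. E \<subseteq> (\<Union>k. C k)}. \<Sum>k. packing_pre0 \<alpha> (C k))"

text \<open>The two limits defining the measures above exist, by monotonicity.\<close>

lemma Lim_at_right_0_antimono:
  fixes f :: "real \<Rightarrow> ennreal"
  assumes anti: "\<And>s t. 0 < s \<Longrightarrow> s \<le> t \<Longrightarrow> f t \<le> f s"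
  shows "Lim (at_right 0) f = (SUP t\<in>{0<..}. f t)"
proof (rule tendsto_Lim)
  show "(f \<longlongrightarrow> (SUP t\<in>{0<..}. f t)) (at_right 0)"
  proof (rule order_tendstoI)
    fix a assume "a < (SUP t\<in>{0<..}. f t)"
    then obtain t where t: "0 < t" "a < f t"
      by (auto simp: less_SUP_iff)
    then show "\<forall>\<^sub>F s in at_right 0. a < f s"
      by (intro eventually_at_rightI[of 0 t]) (auto intro: less_le_trans[OF t(2) anti])
  next
    fix a assume "(SUP t\<in>{0<..}. f t) < a"
    then show "\<forall>\<^sub>F s in at_right 0. f s < a"
      by (intro eventually_at_rightI[of 0 1]) (auto intro: le_less_trans[OF SUP_upper])
  qed
qed simp

lemma hausdorff_measure_eq_SUP:
  "hausdorff_measure \<alpha> E = (SUP \<delta>\<in>{0<..}. hausdorff_pre \<alpha> \<delta> E)"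
  unfolding hausdorff_measure_def hausdorff_pre_def
  by (intro Lim_at_right_0_antimono INF_superset_mono) (auto intro: order_trans)

lemma packing_pre0_eq_INF: "packing_pre0 \<alpha> E = (INF \<delta>\<in>{0<..}. packing_pre \<alpha> \<delta> E)"
proof -
  have mono: "packing_pre \<alpha> s E \<le> packing_pre \<alpha> t E" if "s \<le> t" for s t
    unfolding packing_pre_def
    by (intro SUP_subset_mono) (use that in \<open>fastforce simp: is_packing_def\<close>)+
  have "((\<lambda>\<delta>. packing_pre \<alpha> \<delta> E) \<longlongrightarrow> (INF \<delta>\<in>{0<..}. packing_pre \<alpha> \<delta> E)) (at_right 0)"
  proof (rule order_tendstoI)
    fix a assume "a < (INF \<delta>\<in>{0<..}. packing_pre \<alpha> \<delta> E)"
    then show "\<forall>\<^sub>F s in at_right 0. a < packing_pre \<alpha> s E"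
      by (intro eventually_at_rightI[of 0 1]) (auto intro: less_le_trans[OF _ INF_lower])
  next
    fix a assume "(INF \<delta>\<in>{0<..}. packing_pre \<alpha> \<delta> E) < a"
    then obtain t where t: "0 < t" "packing_pre \<alpha> t E < a"
      by (auto simp: INF_less_iff)
    then show "\<forall>\<^sub>F s in at_right 0. packing_pre \<alpha> s E < a"
      by (intro eventually_at_rightI[of 0 t]) (auto intro: le_less_trans[OF mono t(2)])
  qed
  then show ?thesis
    unfolding packing_pre0_def by (intro tendsto_Lim) auto
qed

definition hausdorff_dim :: "'a::metric_space set \<Rightarrow> ereal" where
  "hausdorff_dim E = Inf {ereal \<alpha> | \<alpha>. 0 < \<alpha> \<and> hausdorff_measure \<alpha> E = 0}"

definition packing_dim :: "'a::metric_space set \<Rightarrow> ereal" where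
  "packing_dim E = Inf {ereal \<alpha> | \<alpha>. 0 < \<alpha> \<and> packing_measure \<alpha> E = 0}"


section \<open>Dimensions of measures\<close>

text \<open>The parameter \<open>D\<close> is one of \<^const>\<open>hausdorff_dim\<close>, \<^const>\<open>packing_dim\<close>.\<close>

definition lower_measure_dim ::
  "('a::metric_space set \<Rightarrow> ereal) \<Rightarrow> 'a measure \<Rightarrow> ereal" where
  "lower_measure_dim D \<mu> = (INF E \<in> {E \<in> sets borel. 0 < emeasure \<mu> E}. D E)"

definition upper_measure_dim ::
  "('a::metric_space set \<Rightarrow> ereal) \<Rightarrow> 'a measure \<Rightarrow> ereal" where
  "upper_measure_dim D \<mu> = (INF E \<in> {E \<in> sets borel. emeasure \<mu> (- E) = 0}. D E)"

definition has_measure_dim ::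
  "('a::metric_space set \<Rightarrow> ereal) \<Rightarrow> 'a measure \<Rightarrow> ereal \<Rightarrow> bool" where
  "has_measure_dim D \<mu> c \<longleftrightarrow> lower_measure_dim D \<mu> = c \<and> upper_measure_dim D \<mu> = c"


section \<open>Local dimensions and recurrence rates\<close>

definition upper_local_dim :: "'a::metric_space measure \<Rightarrow> 'a \<Rightarrow> ereal" where
  "upper_local_dim \<mu> x =
     (if \<forall>\<epsilon>>0. 0 < measure \<mu> (ball x \<epsilon>)
      then Limsup (at_right 0) (\<lambda>\<epsilon>. ereal (ln (measure \<mu> (ball x \<epsilon>)) / ln \<epsilon>))
      else \<infinity>)"

definition lower_local_dim :: "'a::metric_space measure \<Rightarrow> 'a \<Rightarrow> ereal" where
  "lower_local_dim \<mu> x =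
     (if \<forall>\<epsilon>>0. 0 < measure \<mu> (ball x \<epsilon>)
      then Liminf (at_right 0) (\<lambda>\<epsilon>. ereal (ln (measure \<mu> (ball x \<epsilon>)) / ln \<epsilon>))
      else \<infinity>)"

definition return_time :: "('a::metric_space \<Rightarrow> 'a) \<Rightarrow> real \<Rightarrow> 'a \<Rightarrow> enat" where
  "return_time T r x = Inf {enat k | k. 1 \<le> k \<and> (T ^^ k) x \<in> cball x r}"

definition ln_enat :: "enat \<Rightarrow> ereal" where
  "ln_enat n = (case n of enat k \<Rightarrow> ereal (ln (real k)) | \<infinity> \<Rightarrow> \<infinity>)"

definition lower_recurrence_rate :: "('a::metric_space \<Rightarrow> 'a) \<Rightarrow> 'a \<Rightarrow> ereal" where
  "lower_recurrence_rate T x =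
     Liminf (at_right 0) (\<lambda>r. ln_enat (return_time T r x) / ereal (- ln r))"

definition upper_recurrence_rate :: "('a::metric_space \<Rightarrow> 'a) \<Rightarrow> 'a \<Rightarrow> ereal" where
  "upper_recurrence_rate T x =
     Limsup (at_right 0) (\<lambda>r. ln_enat (return_time T r x) / ereal (- ln r))"


section \<open>Invariant and ergodic measures\<close>

definition invariant_measure :: "('a \<Rightarrow> 'a) \<Rightarrow> 'a measure \<Rightarrow> bool" where
  "invariant_measure T \<mu> \<longleftrightarrow>
     T \<in> measurable \<mu> \<mu> \<and> (\<forall>A\<in>sets \<mu>. emeasure \<mu> (T -` A \<inter> space \<mu>) = emeasure \<mu> A)"

definition ergodic_measure :: "('a \<Rightarrow> 'a) \<Rightarrow> 'a measure \<Rightarrow> bool" where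
  "ergodic_measure T \<mu> \<longleftrightarrow>
     (\<forall>A\<in>sets \<mu>. T -` A \<inter> space \<mu> = A \<longrightarrow> emeasure \<mu> A = 0 \<or> emeasure \<mu> (space \<mu> - A) = 0)"

end

theory Submission
  imports Defs
begin

text \<open>
  The assertions about the recurrence rates are hypotheses; those about the local dimensions hold
  for every Borel probability measure on a metric space, in the form
  \<open>lower local dimension \<le> dim\<^sub>H\<^sup>+\<close> and \<open>dim\<^sub>P\<^sup>- \<le> upper local dimension\<close> almost everywhere.
  On the set of points with \<open>\<mu>(B(x, \<epsilon>)) \<le> \<epsilon>\<^sup>\<alpha>\<close> for all small \<open>\<epsilon>\<close>, an efficient cover of a
  set of zero \<open>\<alpha>\<close>-dimensional Hausdorff measure has small total mass. On the set of points with
  \<open>\<mu>(B(x, q)) > q\<^sup>s\<close> for all small rational \<open>q\<close>, disjointness of the balls of a packing bounds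
  \<open>\<Sum> (2 r\<^sub>k)\<^sup>s\<close> by a constant multiple of the total mass, so this set has packing dimension at
  most \<open>s\<close>.
\<close>

section \<open>Lower semicontinuity of the mass of open balls\<close>

text \<open>Continuity from below gives a slightly smaller concentric ball with mass still above
  \<open>a\<close>, and that ball lies in \<open>ball y r\<close> for every \<open>y\<close> close
  to \<open>x\<close>. This makes the level sets in the packing argument Borel.\<close>

lemma open_measure_ball_greater:
  fixes M :: "'a::metric_space measure"
  assumes "finite_measure M" and sets: "sets M = sets borel"
  shows "open {x. a < measure M (ball x r)}"
  unfolding open_contains_ball
proof safe
  fix x assume a: "a < measure M (ball x r)"
  interpret finite_measure M by fact
  let ?B = "\<lambda>n. ball x (r - 1 / real (Suc n))"
  have U: "(\<Union>n. ?B n) = ball x r"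
  proof safe
    fix y n assume "y \<in> ?B n"
    moreover have "0 < 1 / real (Suc n)" by simp
    ultimately show "y \<in> ball x r" by (simp only: mem_ball)
  next
    fix y assume "y \<in> ball x r"
    then obtain n where "inverse (real (Suc n)) < r - dist x y"
      using reals_Archimedean[of "r - dist x y"] by auto
    then have "y \<in> ?B n" by (simp only: mem_ball inverse_eq_divide)
    then show "y \<in> (\<Union>n. ?B n)" by blast
  qed
  have "incseq ?B"
    by (rule incseq_SucI) (auto intro!: subset_ball diff_left_mono divide_left_mono)
  moreover have "range ?B \<subseteq> sets M" unfolding sets by auto
  ultimately have "(\<lambda>n. measure M (?B n)) \<longlonglongrightarrow> measure M (ball x r)"
    using finite_Lim_measure_incseq[of ?B] U by simp
  from order_tendstoD(1)[OF this a] obtain n where n: "a < measure M (?B n)"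
    by (auto simp: eventually_sequentially)
  have "ball x (1 / real (Suc n)) \<subseteq> {x. a < measure M (ball x r)}"
  proof
    fix y assume y: "y \<in> ball x (1 / real (Suc n))"
    have "?B n \<subseteq> ball y r"
    proof
      fix z assume "z \<in> ?B n"
      then show "z \<in> ball y r"
        using y dist_triangle[of y z x] by (simp only: mem_ball dist_commute[of y x])
    qed
    then have "measure M (?B n) \<le> measure M (ball y r)"
      by (intro finite_measure_mono) (auto simp: sets)
    with n show "y \<in> {x. a < measure M (ball x r)}" by simp
  qed
  then show "\<exists>e>0. ball x e \<subseteq> {x. a < measure M (ball x r)}"
    by (intro exI[of _ "1 / real (Suc n)"]) auto
qed

section \<open>Hausdorff dimension and the lower local dimension\<close>

text \<open>A form of the mass distribution principle. Neither \<open>E\<close> nor \<open>A\<close>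
  is assumed measurable, so the conclusion is containment in a null set.\<close>

lemma null_measure_if_hausdorff_null:
  fixes M :: "'a::metric_space measure"
  assumes "finite_measure M" and sets: "sets M = sets borel"
    and "0 < \<alpha>" and H: "hausdorff_measure \<alpha> E = 0"
    and "0 < \<eta>"
    and A: "\<And>x \<epsilon>. x \<in> A \<Longrightarrow> 0 < \<epsilon> \<Longrightarrow> \<epsilon> < \<eta> \<Longrightarrow> measure M (ball x \<epsilon>) \<le> \<epsilon> powr \<alpha>"
  shows "\<exists>N\<in>null_sets M. E \<inter> A \<subseteq> N"
proof -
  interpret finite_measure M by fact
  \<comment> \<open>The Hausdorff measure is the supremum over all scales, so it may be tested at
    one. At \<open>\<eta> / 3\<close>, doubling a radius stays below \<open>\<eta>\<close>.\<close>
  have pre: "hausdorff_pre \<alpha> (\<eta> / 3) E = 0"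
    using SUP_upper[of "\<eta> / 3" "{0<..}" "\<lambda>\<delta>. hausdorff_pre \<alpha> \<delta> E"] H \<open>0 < \<eta>\<close>
    by (simp add: hausdorff_measure_eq_SUP)
  \<comment> \<open>Covering sets will be enclosed in closed balls, while the hypothesis concerns
    open ones: doubling the radius costs \<open>2 powr \<alpha>\<close>. Covering sets of diameter 0
    require the case \<open>d = 0\<close>, where the bound says that single points of
    \<open>A\<close> are null.\<close>
  have cball_le: "measure M (cball x d) \<le> 2 powr \<alpha> * d powr \<alpha>"
    if x: "x \<in> A" and d: "0 \<le> d" "d \<le> \<eta> / 3" for x d
  proof (cases "d = 0")
    case False
    have "measure M (cball x d) \<le> measure M (ball x (2 * d))"
      using d False by (intro finite_measure_mono) (auto simp: sets)
    also have "\<dots> \<le> (2 * d) powr \<alpha>"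
      using d False \<open>0 < \<eta>\<close> by (intro A[OF x]) auto
    finally show ?thesis using d by (simp add: powr_mult)
  next
    case True
    have "measure M (cball x 0) \<le> e" if "0 < e" for e
    proof -
      \<comment> \<open>The first entry forces \<open>r powr \<alpha> \<le> e\<close>, the second
        keeps \<open>r\<close> below \<open>\<eta>\<close>.\<close>
      define r where "r = min (e powr (1 / \<alpha>)) (\<eta> / 2)"
      have r: "0 < r" "r < \<eta>" "r \<le> e powr (1 / \<alpha>)"
        using that \<open>0 < \<eta>\<close> by (auto simp: r_def)
      have "measure M (cball x 0) \<le> measure M (ball x r)"
        using r by (intro finite_measure_mono) (auto simp: sets)
      also have "\<dots> \<le> r powr \<alpha>" by (rule A[OF x r(1,2)])
      also have "\<dots> \<le> (e powr (1 / \<alpha>)) powr \<alpha>"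
        using r \<open>0 < \<alpha>\<close> by (intro powr_mono2) auto
      also have "\<dots> = e" using that \<open>0 < \<alpha>\<close> by (simp add: powr_powr)
      finally show ?thesis .
    qed
    then have "measure M (cball x 0) \<le> 0" by (intro field_le_epsilon[of _ 0]) (simp only: add_0_left)
    then show ?thesis using True by simp
  qed
  have ex: "\<exists>V\<in>sets M. E \<inter> A \<subseteq> V \<and> emeasure M V \<le> ennreal (2 powr \<alpha> * e)"
    if e: "0 < e" for e
  proof -
    have "hausdorff_pre \<alpha> (\<eta> / 3) E < ennreal e" using pre e by simp
    then obtain C where C: "E \<subseteq> (\<Union>k. C k)" "\<And>k. bounded (C k)" "\<And>k. diameter (C k) \<le> \<eta> / 3"
      and sum: "(\<Sum>k. ennreal (diameter (C k) powr \<alpha>)) < ennreal e"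
      by (auto simp: hausdorff_pre_def INF_less_iff)
    \<comment> \<open>The sets \<open>C k\<close> may fail to be measurable and their points may lie
      outside \<open>A\<close>. Each one meeting \<open>A\<close> is replaced by a closed ball
      centred in \<open>A\<close>, which contains it because the radius is its diameter.\<close>
    define U where "U k = (if C k \<inter> A = {} then {}
      else cball (SOME x. x \<in> C k \<inter> A) (diameter (C k)))" for k
    have U: "U k \<in> sets M" for k by (simp add: U_def sets)
    have cover: "E \<inter> A \<subseteq> (\<Union>k. U k)"
    proof
      fix y assume y: "y \<in> E \<inter> A"
      then obtain k where k: "y \<in> C k" using C by auto
      then have ne: "C k \<inter> A \<noteq> {}" using y by auto
      then have "(SOME x. x \<in> C k \<inter> A) \<in> C k \<inter> A" unfolding some_in_eq .
      then have "dist (SOME x. x \<in> C k \<inter> A) y \<le> diameter (C k)"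
        using k by (intro diameter_bounded_bound C) auto
      then show "y \<in> (\<Union>k. U k)" using ne by (auto simp: U_def)
    qed
    have Uk: "emeasure M (U k) \<le> ennreal (2 powr \<alpha>) * ennreal (diameter (C k) powr \<alpha>)" for k
    proof (cases "C k \<inter> A = {}")
      case False
      then have "(SOME x. x \<in> C k \<inter> A) \<in> C k \<inter> A" unfolding some_in_eq .
      then have "measure M (U k) \<le> 2 powr \<alpha> * diameter (C k) powr \<alpha>"
        using False C by (auto simp: U_def intro!: cball_le diameter_ge_0)
      then show ?thesis
        by (simp add: emeasure_eq_measure ennreal_leI flip: ennreal_mult)
    qed (simp add: U_def)
    have "emeasure M (\<Union>k. U k) \<le> (\<Sum>k. emeasure M (U k))"
      using U by (intro emeasure_subadditive_countably) auto
    also have "\<dots> \<le> (\<Sum>k. ennreal (2 powr \<alpha>) * ennreal (diameter (C k) powr \<alpha>))"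
      using Uk by (intro suminf_le) auto
    also have "\<dots> = ennreal (2 powr \<alpha>) * (\<Sum>k. ennreal (diameter (C k) powr \<alpha>))"
      by (rule ennreal_suminf_cmult)
    also have "\<dots> \<le> ennreal (2 powr \<alpha>) * ennreal e"
      using sum by (intro mult_left_mono) auto
    finally have "emeasure M (\<Union>k. U k) \<le> ennreal (2 powr \<alpha> * e)"
      using e by (simp add: ennreal_mult)
    with U cover show ?thesis by (intro bexI[of _ "\<Union>k. U k"]) auto
  qed
  have "\<forall>n. \<exists>V\<in>sets M. E \<inter> A \<subseteq> V \<and> emeasure M V \<le> ennreal (2 powr \<alpha> * (1 / real (Suc n)))"
    by (intro allI ex) simp
  then obtain V where V: "\<And>n. V n \<in> sets M" "\<And>n. E \<inter> A \<subseteq> V n"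
    "\<And>n. emeasure M (V n) \<le> ennreal (2 powr \<alpha> * (1 / real (Suc n)))"
    by metis
  \<comment> \<open>The intersection of the measurable covers is a single measurable superset of
    \<open>E \<inter> A\<close> with mass below every bound.\<close>
  have "emeasure M (\<Inter>n. V n) \<le> ennreal (2 powr \<alpha> * (1 / real (Suc n)))" for n
    using V by (intro order_trans[OF emeasure_mono V(3)]) auto
  moreover have "(\<lambda>n. ennreal (2 powr \<alpha> * (1 / real (Suc n)))) \<longlonglongrightarrow> ennreal (2 powr \<alpha> * 0)"
    by (intro tendsto_ennrealI tendsto_mult tendsto_const lim_1_over_n[THEN LIMSEQ_Suc])
  ultimately have "emeasure M (\<Inter>n. V n) \<le> 0"
    using LIMSEQ_le_const by fastforce
  then show ?thesis using V by (intro bexI[of _ "\<Inter>n. V n"]) (auto intro: null_setsI)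
qed

lemma measure_ball_le_if_lower_local_dim_greater:
  fixes M :: "'a::metric_space measure"
  assumes "finite_measure M" and sets: "sets M = sets borel"
    and "ereal \<alpha> < lower_local_dim M x"
  obtains \<eta> where "0 < \<eta>" "\<And>\<epsilon>. 0 < \<epsilon> \<Longrightarrow> \<epsilon> < \<eta> \<Longrightarrow> measure M (ball x \<epsilon>) \<le> \<epsilon> powr \<alpha>"
proof (cases "\<forall>\<epsilon>>0. 0 < measure M (ball x \<epsilon>)")
  case True
  then have "ereal \<alpha> < Liminf (at_right 0) (\<lambda>\<epsilon>. ereal (ln (measure M (ball x \<epsilon>)) / ln \<epsilon>))"
    using assms by (simp add: lower_local_dim_def)
  then have "\<forall>\<^sub>F \<epsilon> in at_right 0. ereal \<alpha> < ereal (ln (measure M (ball x \<epsilon>)) / ln \<epsilon>)"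
    by (rule less_LiminfD)
  then obtain b where b: "0 < b" "\<And>\<epsilon>. 0 < \<epsilon> \<Longrightarrow> \<epsilon> < b \<Longrightarrow> \<alpha> < ln (measure M (ball x \<epsilon>)) / ln \<epsilon>"
    by (auto simp: eventually_at_right_field)
  show thesis
  proof (rule that[of "min b 1"])
    fix \<epsilon> :: real assume \<epsilon>: "0 < \<epsilon>" "\<epsilon> < min b 1"
    \<comment> \<open>Here \<open>\<epsilon> < 1\<close> makes \<open>ln \<epsilon>\<close>
      negative, which reverses the inequality.\<close>
    then have "ln (measure M (ball x \<epsilon>)) < \<alpha> * ln \<epsilon>"
      using b(2)[of \<epsilon>] by (simp add: less_divide_eq)
    then have "exp (ln (measure M (ball x \<epsilon>))) \<le> exp (\<alpha> * ln \<epsilon>)" by simp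
    then show "measure M (ball x \<epsilon>) \<le> \<epsilon> powr \<alpha>" using \<epsilon> True by (simp add: powr_def)
  qed (use b in auto)
next
  case False
  \<comment> \<open>The local dimension is infinite by convention here; all smaller balls are null
    as well, so the power bound is trivial.\<close>
  then obtain b where b: "0 < b" "measure M (ball x b) = 0"
    by (meson measure_nonneg order_le_less not_less)
  interpret finite_measure M by fact
  show thesis
  proof (rule that[OF b(1)])
    fix \<epsilon> :: real assume \<epsilon>: "0 < \<epsilon>" "\<epsilon> < b"
    have "measure M (ball x \<epsilon>) \<le> measure M (ball x b)"
      using \<epsilon> by (intro finite_measure_mono) (auto simp: sets)
    also have "\<dots> \<le> \<epsilon> powr \<alpha>" using b by simp
    finally show "measure M (ball x \<epsilon>) \<le> \<epsilon> powr \<alpha>" .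
  qed
qed

text \<open>Where the lower local dimension exceeds \<open>s > \<alpha>\<close>, the ball bound
  holds below some scale \<open>1 / (n + 1)\<close>. Such points of \<open>E\<close> fall into
  countably many null sets, and the complement of \<open>E\<close> is null.\<close>

lemma AE_lower_local_dim_le_upper_hausdorff_dim:
  fixes M :: "'a::metric_space measure"
  assumes "finite_measure M" and sets: "sets M = sets borel"
  shows "AE x in M. lower_local_dim M x \<le> upper_measure_dim hausdorff_dim M"
proof -
  let ?D = "upper_measure_dim hausdorff_dim M"
  have AE_le: "AE x in M. lower_local_dim M x \<le> ereal s" if s: "?D < ereal s" for s
  proof -
    from s obtain E where E: "E \<in> sets borel" "emeasure M (- E) = 0" "hausdorff_dim E < ereal s"
      by (auto simp: upper_measure_dim_def INF_less_iff)
    then obtain \<alpha> where \<alpha>: "0 < \<alpha>" "hausdorff_measure \<alpha> E = 0" "\<alpha> < s"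
      by (auto simp: hausdorff_dim_def Inf_less_iff)
    define A where "A n = {x. \<forall>\<epsilon>. 0 < \<epsilon> \<longrightarrow> \<epsilon> < 1 / real (Suc n) \<longrightarrow>
      measure M (ball x \<epsilon>) \<le> \<epsilon> powr \<alpha>}" for n
    have "\<exists>N\<in>null_sets M. E \<inter> A n \<subseteq> N" for n
      by (rule null_measure_if_hausdorff_null[OF assms \<alpha>(1,2), of "1 / real (Suc n)"])
        (auto simp: A_def)
    then obtain N where N: "\<And>n. N n \<in> null_sets M" "\<And>n. E \<inter> A n \<subseteq> N n" by metis
    have "- E \<in> null_sets M" using E by (auto simp: sets)
    then have "- E \<union> (\<Union>n. N n) \<in> null_sets M" using N by auto
    then show ?thesis
    proof (rule AE_I', intro subsetI)
      fix x assume x: "x \<in> {x \<in> space M. \<not> lower_local_dim M x \<le> ereal s}"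
      have "ereal \<alpha> < lower_local_dim M x"
        using x \<alpha> by (auto simp: not_le intro: less_trans[of _ "ereal s"])
      then obtain \<eta> where \<eta>: "0 < \<eta>" "\<And>\<epsilon>. 0 < \<epsilon> \<Longrightarrow> \<epsilon> < \<eta> \<Longrightarrow> measure M (ball x \<epsilon>) \<le> \<epsilon> powr \<alpha>"
        using measure_ball_le_if_lower_local_dim_greater[OF assms] by blast
      obtain n where "1 / real (Suc n) < \<eta>"
        using reals_Archimedean[OF \<eta>(1)] by (auto simp: inverse_eq_divide)
      then have "x \<in> A n" using \<eta> by (auto simp: A_def)
      with N show "x \<in> - E \<union> (\<Union>n. N n)" by auto
    qed
  qed
  \<comment> \<open>Rational thresholds merge the exceptional null sets into one, and some rational
    separates any two distinct extended reals.\<close>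
  have "AE x in M. \<forall>q::rat. ?D < ereal (real_of_rat q) \<longrightarrow> lower_local_dim M x \<le> ereal (real_of_rat q)"
    unfolding AE_all_countable using AE_le by auto
  then show ?thesis
  proof eventually_elim
    case (elim x)
    show ?case
    proof (rule ccontr)
      assume "\<not> ?thesis"
      then obtain q where "?D < ereal (real_of_rat q)" "ereal (real_of_rat q) < lower_local_dim M x"
        using ereal_dense3[of ?D "lower_local_dim M x"] by (auto simp: not_le)
      with elim show False by (auto simp: not_le)
    qed
  qed
qed

section \<open>Packing dimension and the upper local dimension\<close>

text \<open>Only rational radii occur in the assumption, so that the set of such points is Borel.\<close>

lemma packing_dim_le_if_measure_ball_greater:
  fixes M :: "'a::metric_space measure"
  assumes "finite_measure M" and sets: "sets M = sets borel"
    and "0 < s" "s < t" "0 < \<eta>"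
    and G: "\<And>x q. x \<in> G \<Longrightarrow> q \<in> \<rat> \<Longrightarrow> 0 < q \<Longrightarrow> q < \<eta> \<Longrightarrow> q powr s < measure M (ball x q)"
  shows "packing_dim G \<le> ereal t"
proof -
  interpret finite_measure M by fact
  define K where "K = 4 powr s * measure M (space M)"
  \<comment> \<open>A rational \<open>q\<close> strictly between \<open>r / 2\<close> and
    \<open>r\<close> satisfies \<open>2 * r \<le> 4 * q\<close>, whence the constant
    \<open>4 powr s\<close>.\<close>
  have ball: "(2 * r) powr s \<le> 4 powr s * measure M (cball x r)"
    if x: "x \<in> G" and r: "0 < r" "r < \<eta>" for x r
  proof -
    obtain q where q: "q \<in> \<rat>" "r / 2 < q" "q < r"
      using Rats_dense_in_real[of "r / 2" r] r by auto
    have "(2 * r) powr s \<le> (4 * q) powr s"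
      using q r \<open>0 < s\<close> by (intro powr_mono2) auto
    also have "\<dots> = 4 powr s * q powr s" using q r by (simp add: powr_mult)
    also have "q powr s \<le> measure M (ball x q)"
      using q r by (intro less_imp_le G[OF x]) auto
    also have "\<dots> \<le> measure M (cball x r)"
      using q by (intro finite_measure_mono) (auto simp: sets)
    finally show ?thesis by simp
  qed
  \<comment> \<open>The surplus exponent \<open>t - s\<close> gives the factor
    \<open>\<delta> powr (t - s)\<close>, which vanishes with the scale; the remaining sum is at
    most \<open>K\<close> by disjointness of the balls.\<close>
  have pre: "packing_pre t \<delta> G \<le> ennreal (\<delta> powr (t - s) * K)" if \<delta>: "0 < \<delta>" "\<delta> < \<eta>" for \<delta>
    unfolding packing_pre_def
  proof (rule SUP_least, clarify)
    fix I :: "nat set" and c :: "nat \<Rightarrow> 'a" and r :: "nat \<Rightarrow> real"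
    assume P: "is_packing \<delta> G I c r"
    have "sum (\<lambda>k. ennreal ((2 * r k) powr t)) F \<le> ennreal (\<delta> powr (t - s) * K)"
      if F: "finite F" "F \<subseteq> I" for F
    proof -
      have r: "c k \<in> G" "0 < r k" "r k \<le> \<delta> / 2" if "k \<in> F" for k
        using P F that by (auto simp: is_packing_def)
      have "(\<Sum>k\<in>F. (2 * r k) powr t)
          \<le> (\<Sum>k\<in>F. \<delta> powr (t - s) * (4 powr s * measure M (cball (c k) (r k))))"
      proof (rule sum_mono)
        fix k assume k: "k \<in> F"
        have "(2 * r k) powr t = (2 * r k) powr (t - s) * (2 * r k) powr s"
          by (simp flip: powr_add)
        also have "\<dots> \<le> \<delta> powr (t - s) * (4 powr s * measure M (cball (c k) (r k)))"
          using r[OF k] \<delta> \<open>s < t\<close> by (intro mult_mono powr_mono2 ball) auto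
        finally show "(2 * r k) powr t
          \<le> \<delta> powr (t - s) * (4 powr s * measure M (cball (c k) (r k)))" .
      qed
      also have "\<dots> = \<delta> powr (t - s) * (4 powr s * (\<Sum>k\<in>F. measure M (cball (c k) (r k))))"
        by (simp add: sum_distrib_left)
      also have "(\<Sum>k\<in>F. measure M (cball (c k) (r k))) = measure M (\<Union>k\<in>F. cball (c k) (r k))"
        using F P
        by (intro finite_measure_finite_Union[symmetric])
          (auto simp: sets is_packing_def intro: disjoint_family_on_mono)
      also have "\<delta> powr (t - s) * (4 powr s * \<dots>) \<le> \<delta> powr (t - s) * K"
        unfolding K_def by (intro mult_left_mono bounded_measure) auto
      finally show ?thesis by (simp add: ennreal_leI)
    qed
    then show "(\<Sum>\<^sub>\<infinity>k\<in>I. ennreal ((2 * r k) powr t)) \<le> ennreal (\<delta> powr (t - s) * K)"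
      by (intro infsum_le_finite_sums nonneg_summable_on_complete) auto
  qed
  have "packing_pre0 t G \<le> ennreal (0 * K)"
  proof (rule tendsto_lowerbound)
    have "((\<lambda>\<delta>::real. \<delta> powr (t - s)) \<longlongrightarrow> 0) (at_right 0)"
      using \<open>s < t\<close>
      by (intro tendsto_eq_intros tendsto_zero_powrI[where b = "t - s"])
        (auto simp: eventually_at_right_field intro!: exI[of _ 1])
    then show "((\<lambda>\<delta>. ennreal (\<delta> powr (t - s) * K)) \<longlongrightarrow> ennreal (0 * K)) (at_right 0)"
      by (intro tendsto_ennrealI tendsto_mult tendsto_const)
    show "\<forall>\<^sub>F \<delta> in at_right 0. packing_pre0 t G \<le> ennreal (\<delta> powr (t - s) * K)"
      unfolding packing_pre0_eq_INF
      by (rule eventually_at_rightI[of 0 \<eta>]) (auto intro!: INF_lower2 pre \<open>0 < \<eta>\<close>)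
  qed simp
  then have "packing_pre0 t G = 0" by simp
  then have "packing_measure t G \<le> 0"
    unfolding packing_measure_def by (intro INF_lower2[of "\<lambda>_. G"]) auto
  then show ?thesis
    unfolding packing_dim_def using \<open>0 < s\<close> \<open>s < t\<close> by (intro Inf_lower) auto
qed

text \<open>A finite bound excludes the conventional value \<open>\<infinity>\<close>, so every ball
  has positive mass and logarithms can be exponentiated back.\<close>

lemma measure_ball_greater_if_upper_local_dim_less:
  fixes M :: "'a::metric_space measure"
  assumes "upper_local_dim M x < ereal s"
  obtains \<eta> where "0 < \<eta>" "\<And>\<epsilon>. 0 < \<epsilon> \<Longrightarrow> \<epsilon> < \<eta> \<Longrightarrow> \<epsilon> powr s < measure M (ball x \<epsilon>)"
proof -
  have pos: "\<forall>\<epsilon>>0. 0 < measure M (ball x \<epsilon>)"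
    using assms by (auto simp: upper_local_dim_def split: if_splits)
  then have "Limsup (at_right 0) (\<lambda>\<epsilon>. ereal (ln (measure M (ball x \<epsilon>)) / ln \<epsilon>)) < ereal s"
    using assms by (simp add: upper_local_dim_def)
  then have "\<forall>\<^sub>F \<epsilon> in at_right 0. ereal (ln (measure M (ball x \<epsilon>)) / ln \<epsilon>) < ereal s"
    by (rule Limsup_lessD)
  then obtain b where b: "0 < b" "\<And>\<epsilon>. 0 < \<epsilon> \<Longrightarrow> \<epsilon> < b \<Longrightarrow> ln (measure M (ball x \<epsilon>)) / ln \<epsilon> < s"
    by (auto simp: eventually_at_right_field)
  show thesis
  proof (rule that[of "min b 1"])
    fix \<epsilon> :: real assume \<epsilon>: "0 < \<epsilon>" "\<epsilon> < min b 1"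
    then have "s * ln \<epsilon> < ln (measure M (ball x \<epsilon>))"
      using b(2)[of \<epsilon>] by (simp add: divide_less_eq)
    then have "exp (s * ln \<epsilon>) < exp (ln (measure M (ball x \<epsilon>)))" by simp
    then show "\<epsilon> powr s < measure M (ball x \<epsilon>)" using \<epsilon> pos by (simp add: powr_def)
  qed (use b in auto)
qed

text \<open>For \<open>\<epsilon> < 1\<close> both logarithms are nonpositive because masses are at
  most 1; a null ball is covered by the default \<open>ln 0 = 0\<close>.\<close>

lemma eventually_local_dim_quotient_nonneg:
  assumes "prob_space M"
  shows "\<forall>\<^sub>F \<epsilon> in at_right 0. 0 \<le> ereal (ln (measure M (ball x \<epsilon>)) / ln \<epsilon>)"
proof (rule eventually_at_rightI[of 0 1])
  fix \<epsilon> :: real assume "\<epsilon> \<in> {0<..<1}"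
  moreover have "ln (measure M (ball x \<epsilon>)) \<le> 0"
    using prob_space.prob_le_1[OF assms, of "ball x \<epsilon>"] measure_nonneg[of M "ball x \<epsilon>"]
    by (cases "measure M (ball x \<epsilon>) = 0") (auto simp: less_le)
  ultimately show "0 \<le> ereal (ln (measure M (ball x \<epsilon>)) / ln \<epsilon>)"
    by (auto intro!: divide_nonpos_neg)
qed simp

lemma lower_local_dim_nonneg: "prob_space M \<Longrightarrow> 0 \<le> lower_local_dim M x"
  unfolding lower_local_dim_def
  using eventually_local_dim_quotient_nonneg[of M x] by (auto intro!: Liminf_bounded)

lemma upper_local_dim_nonneg: "prob_space M \<Longrightarrow> 0 \<le> upper_local_dim M x"
  unfolding upper_local_dim_def
  using eventually_local_dim_quotient_nonneg[of M x] by (auto intro!: le_Limsup)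

text \<open>Points of upper local dimension below \<open>s\<close> lie in Borel sets
  \<open>G n\<close> of packing dimension at most \<open>t\<close>. As \<open>t\<close> is below the
  lower packing dimension of the measure, each \<open>G n\<close> must be null.\<close>

lemma AE_lower_packing_dim_le_upper_local_dim:
  fixes M :: "'a::metric_space measure"
  assumes "prob_space M" and sets: "sets M = sets borel"
  shows "AE x in M. lower_measure_dim packing_dim M \<le> upper_local_dim M x"
proof -
  interpret prob_space M by fact
  let ?D = "lower_measure_dim packing_dim M"
  have AE_ge: "AE x in M. ereal s \<le> upper_local_dim M x" if s: "0 < s" "ereal s < ?D" for s
  proof -
    \<comment> \<open>The packing estimate loses an arbitrarily small amount of exponent, so room is
      left between \<open>s\<close> and \<open>?D\<close>.\<close>
    obtain t where t: "s < t" "ereal t < ?D"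
      using ereal_dense2[OF s(2)] by auto
    define G where "G n = (\<Inter>q\<in>\<rat> \<inter> {0<..<1 / real (Suc n)}. {x. q powr s < measure M (ball x q)})" for n
    have borel_G: "G n \<in> sets borel" for n
    proof -
      obtain q where "q \<in> \<rat>" "0 < q" "q < 1 / real (Suc n)"
        using Rats_dense_in_real[of 0 "1 / real (Suc n)"] by auto
      then show ?thesis
        unfolding G_def
        by (intro sets.countable_INT'' borel_open
            open_measure_ball_greater[OF finite_measure_axioms sets])
          (auto intro: countable_subset[OF _ countable_rat])
    qed
    have null_G: "G n \<in> null_sets M" for n
    proof (rule ccontr)
      assume "G n \<notin> null_sets M"
      then have "0 < emeasure M (G n)"
        using borel_G[of n] by (auto simp: null_sets_def sets zero_less_iff_neq_zero)
      then have "?D \<le> packing_dim (G n)"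
        unfolding lower_measure_dim_def using borel_G by (intro INF_lower) auto
      also have "packing_dim (G n) \<le> ereal t"
        by (rule packing_dim_le_if_measure_ball_greater
            [OF finite_measure_axioms sets s(1) t(1), of "1 / real (Suc n)"])
          (auto simp: G_def)
      finally show False using t by simp
    qed
    have "(\<Union>n. G n) \<in> null_sets M" using null_G by auto
    then show ?thesis
    proof (rule AE_I', safe)
      fix x assume "\<not> ereal s \<le> upper_local_dim M x"
      then obtain \<eta> where \<eta>: "0 < \<eta>" "\<And>\<epsilon>. 0 < \<epsilon> \<Longrightarrow> \<epsilon> < \<eta> \<Longrightarrow> \<epsilon> powr s < measure M (ball x \<epsilon>)"
        using measure_ball_greater_if_upper_local_dim_less[of M x s] by (auto simp: not_le)
      obtain n where "1 / real (Suc n) < \<eta>"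
        using reals_Archimedean[OF \<eta>(1)] by (auto simp: inverse_eq_divide)
      then have "x \<in> G n" using \<eta> by (auto simp: G_def)
      then show "x \<in> (\<Union>n. G n)" by auto
    qed
  qed
  have "AE x in M. \<forall>q::rat. 0 < q \<and> ereal (real_of_rat q) < ?D \<longrightarrow>
      ereal (real_of_rat q) \<le> upper_local_dim M x"
    unfolding AE_all_countable using AE_ge by auto
  then show ?thesis
  proof eventually_elim
    case (elim x)
    show ?case
    proof (rule ccontr)
      assume "\<not> ?thesis"
      then obtain q where q: "upper_local_dim M x < ereal (real_of_rat q)" "ereal (real_of_rat q) < ?D"
        using ereal_dense3[of "upper_local_dim M x" ?D] by (auto simp: not_le)
      \<comment> \<open>Nonnegativity of the upper local dimension makes the separating rational
        positive, as the packing estimate demands.\<close>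
      then have "0 < ereal (real_of_rat q)"
        using upper_local_dim_nonneg[OF assms(1), of x] by (meson le_less_trans)
      with elim q show False by (auto simp: not_le)
    qed
  qed
qed

section \<open>Combination of the almost everywhere bounds\<close>

theorem corollary1p1:
  fixes \<mu> :: "('m :: {polish_space, perfect_space}) biseq measure"
  assumes "prob_space \<mu>"
    and "sets \<mu> = sets borel"
    and "invariant_measure full_shift \<mu>"
    and "ergodic_measure full_shift \<mu>"
    and "has_measure_dim hausdorff_dim \<mu> 0"
    and "has_measure_dim packing_dim \<mu> \<infinity>"
    and "AE x in \<mu>. lower_recurrence_rate full_shift x = 0"
    and "AE x in \<mu>. upper_recurrence_rate full_shift x = \<infinity>"
  shows "AE x in \<mu>.
           lower_recurrence_rate full_shift x = 0 \<and> lower_local_dim \<mu> x = 0 \<and>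
           upper_recurrence_rate full_shift x = \<infinity> \<and> upper_local_dim \<mu> x = \<infinity>"
proof -
  have fin: "finite_measure \<mu>" using assms(1) by (simp add: prob_space_def)
  have "AE x in \<mu>. lower_local_dim \<mu> x \<le> 0"
    using AE_lower_local_dim_le_upper_hausdorff_dim[OF fin assms(2)] assms(5)
    by (simp add: has_measure_dim_def)
  moreover have "AE x in \<mu>. \<infinity> \<le> upper_local_dim \<mu> x"
    using AE_lower_packing_dim_le_upper_local_dim[OF assms(1,2)] assms(6)
    by (simp add: has_measure_dim_def)
  ultimately show ?thesis
    using assms(7,8)
  proof eventually_elim
    case (elim x)
    then show ?case using lower_local_dim_nonneg[OF assms(1), of x] by (auto intro: antisym)
  qed
qed

end
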